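(* Let $(\mathbb{X},\Gamma/{\sim})$ be a triple and let $\mathscr{P}$ be the poset of all screens of $(\mathbb{X},\Gamma/{\sim})$, ordered by $\mathfrak{P}\le\mathfrak{P}'$ if $\mathfrak{P}$ refines $\mathfrak{P}'$. If $\mathscr{P}$ is nonempty, then $\mathscr{P}$ has at least one maximal element.
   Context: TRIPLES. A path in a nonempty set $\mathbb{X}$ is any function $\gamma:[0,1]\to\mathbb{X}$; $\mathrm{im}(\gamma)$ is its image. If $\gamma(1)=\gamma'(0)$, then $\gamma\cdot\gamma'$ is the path equal to $\gamma(2t)$ for $0\le t\le\frac12$ and to $\gamma'(2t-1)$ for $\frac12\le t\le1$. A triple $(\mathbb{X},\Gamma/{\sim})$ consists of a nonempty set $\mathbb{X}$, a set $\Gamma$ of paths in $\mathbb{X}$, and an equivalence relation $\sim$ on $\Gamma$ (equivalent paths have the same endpoints) such that: (a) $\gamma,\gamma'\in\Gamma$ with $\gamma(1)=\gamma'(0)$ implies $\gamma\cdot\gamma'\in\Gamma$; (b) if $\gamma\in\Gamma$ and $\phi:[0,1]\to[0,1]$ is weakly order preserving and sends intervals to intervals, then $\gamma\circ\phi\in\Gamma$; (c) all constant paths are in $\Gamma$; (d) a path equivalent to a constant path is constant; (e) if in (b) also $\phi(0)=0$, $\phi(1)=1$, then $\gamma\sim\gamma\circ\phi$; (f) if $\gamma,\gamma',\rho,\rho'\in\Gamma$ and $\rho\cdot\gamma\cdot\rho'$, $\rho\cdot\gamma'\cdot\rho'$ are defined and in $\Gamma$, then $\gamma\sim\gamma'$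 if and only if $\rho\cdot\gamma\cdot\rho'\sim\rho\cdot\gamma'\cdot\rho'$. SCREENS. A screen of $(\mathbb{X},\Gamma/{\sim})$ is a partition $\mathfrak{P}$ of $\mathbb{X}$, whose elements are called pixels, such that: (S1) if $\gamma,\gamma'\in\Gamma$ have the same start and the same end and $\mathrm{im}(\gamma)\subset\mathsf{X}\in\mathfrak{P}$, then $\gamma\sim\gamma'$ if and only if $\mathrm{im}(\gamma')\subset\mathsf{X}$; (S2) any two points $x,y$ of a pixel $\mathsf{X}$ are joined by a finite walk $\gamma_0\cdot\gamma_1^{-1}\cdot\gamma_2\cdots\gamma_{2n-1}^{-1}\cdot\gamma_{2n}$ from $x$ to $y$ (where $\gamma^{-1}$ is $\gamma$ run backwards) with all $\gamma_i\in\Gamma$ and $\mathrm{im}(\gamma_i)\subset\mathsf{X}$; (S3) if $\rho,\gamma\in\Gamma$, $\rho(0)=\gamma(0)$ and $\mathrm{im}(\rho)$ lies in a pixel, then there are $\rho',\gamma'\in\Gamma$ with $\mathrm{im}(\rho')$ in a pixel and $\gamma\cdot\rho'\sim\rho\cdot\gamma'$; dually, if $\rho',\gamma'\in\Gamma$, $\rho'(1)=\gamma'(1)$ and $\mathrm{im}(\rho')$ lies in a pixel, then there are $\rho,\gamma\in\Gamma$ with $\mathrm{im}(\rho)$ in a pixel and $\gamma\cdot\rho'\sim\rho\cdot\gamma'$; (S4) for every $\gamma\in\Gamma$ there are a finite partition $\{I_i\}_{i=1}^n$ of $[0,1]$ into subintervals (listed in increasing order) and pixels $(\mathsf{X}_1,\dots,\mathsf{X}_n)$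 with $\gamma(I_i)\subset\mathsf{X}_i$, where for $i\ne j$ the equality $\mathsf{X}_i=\mathsf{X}_j$ is allowed only if $|i-j|>1$; (S5) if $\gamma,\gamma'\in\Gamma$ have the same start and the same end and admit the same partition $\{I_i\}$ and the same list of pixels as in (S4), then $\gamma\sim\gamma'$. *)

theory Defs
  imports "HOL-Analysis.Analysis"
begin

text \<open>
  A function \<open>[0,1] \<rightarrow> X\<close> is represented by its extensional representative, i.e. an element of
  \<open>{0..1} \<rightarrow>\<^sub>E X\<close>, so that equality of paths is HOL equality. The path operations below
  therefore restrict their results to the unit interval. Paths carry no topology, so the
  library's operations on continuous paths do not apply.
\<close>

type_synonym 'a pth = "real \<Rightarrow> 'a"

definition paths_in :: "'a set \<Rightarrow> 'a pth set"
  where "paths_in X = {0..1} \<rightarrow>\<^sub>E X"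

definition pstart :: "'a pth \<Rightarrow> 'a"
  where "pstart \<gamma> = \<gamma> 0"

definition pend :: "'a pth \<Rightarrow> 'a"
  where "pend \<gamma> = \<gamma> 1"

definition pimg :: "'a pth \<Rightarrow> 'a set"
  where "pimg \<gamma> = \<gamma> ` {0..1}"

definition const_pth :: "'a \<Rightarrow> 'a pth"
  where "const_pth x = (\<lambda>t\<in>{0..1}. x)"

definition pth_rev :: "'a pth \<Rightarrow> 'a pth"
  where "pth_rev \<gamma> = (\<lambda>t\<in>{0..1}. \<gamma> (1 - t))"

text \<open>
  Concatenation is only meaningful when \<open>pend \<gamma> = pstart \<gamma>'\<close>; this condition is stated wherever
  a concatenation is used. Iterated concatenations associate to the left; by \<open>cat_closed\<close> and \<open>equiv_reparam\<close>
  below, the bracketing does not matter up to equivalence.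
\<close>

definition pth_cat :: "'a pth \<Rightarrow> 'a pth \<Rightarrow> 'a pth"  (infixl \<open>\<cdot>\<^sub>p\<close> 75)
  where "\<gamma> \<cdot>\<^sub>p \<gamma>' = (\<lambda>t\<in>{0..1}. if t \<le> 1/2 then \<gamma> (2 * t) else \<gamma>' (2 * t - 1))"

text \<open>Only the values of \<open>\<phi>\<close> on \<open>[0,1]\<close> are relevant.\<close>

definition reparam :: "(real \<Rightarrow> real) \<Rightarrow> bool"
  where "reparam \<phi> \<longleftrightarrow>
    \<phi> \<in> {0..1} \<rightarrow> {0..1} \<and> mono_on {0..1} \<phi> \<and>
    (\<forall>I. I \<subseteq> {0..1} \<and> is_interval I \<longrightarrow> is_interval (\<phi> ` I))"

text \<open>
  \<open>path_triple X \<Gamma> E\<close> is the triple \<open>(X, \<Gamma>/\<sim>)\<close>, where \<open>E\<close> is the equivalence relation \<open>\<sim>\<close>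
  given as a set of pairs.
\<close>

locale path_triple =
  fixes X :: "'a set" and \<Gamma> :: "'a pth set" and E :: "('a pth \<times> 'a pth) set"
  assumes nonempty: "X \<noteq> {}"
    and paths: "\<Gamma> \<subseteq> paths_in X"
    and equivalence: "equiv \<Gamma> E"
    and same_endpoints:
      "\<And>\<gamma> \<gamma>'. (\<gamma>, \<gamma>') \<in> E \<Longrightarrow> pstart \<gamma> = pstart \<gamma>' \<and> pend \<gamma> = pend \<gamma>'"
    and cat_closed:
      "\<And>\<gamma> \<gamma>'. \<lbrakk>\<gamma> \<in> \<Gamma>; \<gamma>' \<in> \<Gamma>; pend \<gamma> = pstart \<gamma>'\<rbrakk> \<Longrightarrow> \<gamma> \<cdot>\<^sub>p \<gamma>' \<in> \<Gamma>"
    and reparam_closed: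
      "\<And>\<gamma> \<phi>. \<lbrakk>\<gamma> \<in> \<Gamma>; reparam \<phi>\<rbrakk> \<Longrightarrow> compose {0..1} \<gamma> \<phi> \<in> \<Gamma>"
    and const_closed: "\<And>x. x \<in> X \<Longrightarrow> const_pth x \<in> \<Gamma>"
    and equiv_const:
      "\<And>\<gamma> x. \<lbrakk>x \<in> X; (\<gamma>, const_pth x) \<in> E\<rbrakk> \<Longrightarrow> \<exists>y\<in>X. \<gamma> = const_pth y"
    and equiv_reparam:
      "\<And>\<gamma> \<phi>. \<lbrakk>\<gamma> \<in> \<Gamma>; reparam \<phi>; \<phi> 0 = 0; \<phi> 1 = 1\<rbrakk> \<Longrightarrow> (\<gamma>, compose {0..1} \<gamma> \<phi>) \<in> E"
    and cancel:
      "\<And>\<gamma> \<gamma>' \<rho> \<rho>'. \<lbrakk>\<gamma> \<in> \<Gamma>; \<gamma>' \<in> \<Gamma>; \<rho> \<in> \<Gamma>; \<rho>' \<in> \<Gamma>;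
          pend \<rho> = pstart \<gamma>; pend \<gamma> = pstart \<rho>';
          pend \<rho> = pstart \<gamma>'; pend \<gamma>' = pstart \<rho>';
          \<rho> \<cdot>\<^sub>p \<gamma> \<cdot>\<^sub>p \<rho>' \<in> \<Gamma>; \<rho> \<cdot>\<^sub>p \<gamma>' \<cdot>\<^sub>p \<rho>' \<in> \<Gamma>\<rbrakk> \<Longrightarrow>
        (\<gamma>, \<gamma>') \<in> E \<longleftrightarrow> (\<rho> \<cdot>\<^sub>p \<gamma> \<cdot>\<^sub>p \<rho>', \<rho> \<cdot>\<^sub>p \<gamma>' \<cdot>\<^sub>p \<rho>') \<in> E"

text \<open>
  The finite walk \<open>\<gamma>\<^sub>0 \<cdot> \<gamma>\<^sub>1\<^sup>-\<^sup>1 \<cdot> \<gamma>\<^sub>2 \<cdots> \<gamma>\<^sub>2\<^sub>n\<^sub>-\<^sub>1\<^sup>-\<^sup>1 \<cdot> \<gamma>\<^sub>2\<^sub>n\<close> is given by its sequence of paths \<open>g\<close>;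
  it is defined iff every step ends where the next one starts.
\<close>

definition walk_step :: "(nat \<Rightarrow> 'a pth) \<Rightarrow> nat \<Rightarrow> 'a pth"
  where "walk_step g i = (if even i then g i else pth_rev (g i))"

definition walk_joined :: "'a pth set \<Rightarrow> 'a set \<Rightarrow> 'a \<Rightarrow> 'a \<Rightarrow> bool"
  where "walk_joined \<Gamma> Y x y \<longleftrightarrow>
    (\<exists>n g. (\<forall>i\<le>2 * n. g i \<in> \<Gamma> \<and> pimg (g i) \<subseteq> Y) \<and>
       pstart (walk_step g 0) = x \<and> pend (walk_step g (2 * n)) = y \<and>
       (\<forall>i<2 * n. pend (walk_step g i) = pstart (walk_step g (Suc i))))"

text \<open>Subintervals may be open, closed, half-open or consist of a single point.\<close>

definition interval_partition :: "real set list \<Rightarrow> bool"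
  where "interval_partition Is \<longleftrightarrow>
    distinct Is \<and> partition_on {0..1} (set Is) \<and> (\<forall>I\<in>set Is. is_interval I) \<and>
    (\<forall>i<length Is. \<forall>j<length Is. i < j \<longrightarrow> (\<forall>s\<in>Is ! i. \<forall>t\<in>Is ! j. s < t))"

text \<open>Consecutive pixels must differ, but a pixel may recur later in the list.\<close>

definition admits :: "'a set set \<Rightarrow> 'a pth \<Rightarrow> real set list \<Rightarrow> 'a set list \<Rightarrow> bool"
  where "admits P \<gamma> Is Ps \<longleftrightarrow>
    interval_partition Is \<and> length Ps = length Is \<and> set Ps \<subseteq> P \<and>
    (\<forall>i<length Is. \<gamma> ` (Is ! i) \<subseteq> Ps ! i) \<and>
    (\<forall>i<length Ps. \<forall>j<length Ps.
       i \<noteq> j \<and> Ps ! i = Ps ! j \<longrightarrow> \<bar>int i - int j\<bar> > 1)"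

definition in_pixel :: "'a set set \<Rightarrow> 'a pth \<Rightarrow> bool"
  where "in_pixel P \<gamma> \<longleftrightarrow> (\<exists>Y\<in>P. pimg \<gamma> \<subseteq> Y)"

definition is_screen ::
    "'a set \<Rightarrow> 'a pth set \<Rightarrow> ('a pth \<times> 'a pth) set \<Rightarrow> 'a set set \<Rightarrow> bool"
  where "is_screen X \<Gamma> E P \<longleftrightarrow>
    partition_on X P \<and>
    (\<forall>\<gamma>\<in>\<Gamma>. \<forall>\<gamma>'\<in>\<Gamma>. \<forall>Y\<in>P.
       pstart \<gamma> = pstart \<gamma>' \<and> pend \<gamma> = pend \<gamma>' \<and> pimg \<gamma> \<subseteq> Y \<longrightarrow>
       ((\<gamma>, \<gamma>') \<in> E \<longleftrightarrow> pimg \<gamma>' \<subseteq> Y)) \<and>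
    (\<forall>Y\<in>P. \<forall>x\<in>Y. \<forall>y\<in>Y. walk_joined \<Gamma> Y x y) \<and>
    (\<forall>\<rho>\<in>\<Gamma>. \<forall>\<gamma>\<in>\<Gamma>. pstart \<rho> = pstart \<gamma> \<and> in_pixel P \<rho> \<longrightarrow>
       (\<exists>\<rho>'\<in>\<Gamma>. \<exists>\<gamma>'\<in>\<Gamma>. in_pixel P \<rho>' \<and>
          pend \<gamma> = pstart \<rho>' \<and> pend \<rho> = pstart \<gamma>' \<and> (\<gamma> \<cdot>\<^sub>p \<rho>', \<rho> \<cdot>\<^sub>p \<gamma>') \<in> E)) \<and>
    (\<forall>\<rho>'\<in>\<Gamma>. \<forall>\<gamma>'\<in>\<Gamma>. pend \<rho>' = pend \<gamma>' \<and> in_pixel P \<rho>' \<longrightarrow>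
       (\<exists>\<rho>\<in>\<Gamma>. \<exists>\<gamma>\<in>\<Gamma>. in_pixel P \<rho> \<and>
          pend \<gamma> = pstart \<rho>' \<and> pend \<rho> = pstart \<gamma>' \<and> (\<gamma> \<cdot>\<^sub>p \<rho>', \<rho> \<cdot>\<^sub>p \<gamma>') \<in> E)) \<and>
    (\<forall>\<gamma>\<in>\<Gamma>. \<exists>Is Ps. admits P \<gamma> Is Ps) \<and>
    (\<forall>\<gamma>\<in>\<Gamma>. \<forall>\<gamma>'\<in>\<Gamma>. \<forall>Is Ps.
       pstart \<gamma> = pstart \<gamma>' \<and> pend \<gamma> = pend \<gamma>' \<and> admits P \<gamma> Is Ps \<and> admits P \<gamma>' Is Ps \<longrightarrow>
       (\<gamma>, \<gamma>') \<in> E)"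

text \<open>
  The underlying set of the poset of screens; its order is \<^const>\<open>refines\<close> \<open>X\<close>, where
  \<open>refines X P Q\<close> means that \<open>P\<close> is finer than \<open>Q\<close>, i.e. \<open>P \<le> Q\<close>.
\<close>

definition screens ::
    "'a set \<Rightarrow> 'a pth set \<Rightarrow> ('a pth \<times> 'a pth) set \<Rightarrow> 'a set set set"
  where "screens X \<Gamma> E = {P. is_screen X \<Gamma> E P}"

end

theory Submission
  imports Defs
begin

text \<open>
  By Zorn's lemma it suffices to bound a nonempty chain \<open>C\<close> of screens from above, and the bound is
  the join: two points share a pixel iff they share a pixel of some member of \<open>C\<close>. By (S4) for one
  member \<open>P\<^sub>0\<close>, a path meets only finitely many \<open>P\<^sub>0\<close>-pixels. Finitely many \<open>P\<^sub>0\<close>-pixels are merged as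
  much as the join ever merges them already at a single stage \<open>P\<close> of the chain. Each screen axiom
  concerns at most two paths or points at a time, so the join inherits it from such a \<open>P\<close>; only
  (S4) needs, in addition, adjacent intervals lying in the same pixel of the join to be merged.
\<close>

section \<open>Interval partitions and the subdivisions of (S4)\<close>

lemma interval_partition_iff:
  "interval_partition Is \<longleftrightarrow>
    sorted_wrt (\<lambda>I J. \<forall>s\<in>I. \<forall>t\<in>J. s < t) Is \<and> \<Union>(set Is) = {0..1} \<and>
    (\<forall>I\<in>set Is. I \<noteq> {} \<and> is_interval I)"
proof -
  \<comment> \<open>Disjointness and distinctness come from the ordering: a point common to two
    pieces would lie strictly before itself, so a nonempty piece cannot recur either.\<close>
  have separated: "distinct Is \<and> disjoint (set Is)"
    if "sorted_wrt (\<lambda>I J. \<forall>s\<in>I. \<forall>t\<in>J. s < t) Is" "{} \<notin> set Is" for Is :: "real set list"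
    using that
  proof (induction Is)
    case (Cons I Is)
    have "I \<inter> J = {}" if "J \<in> set Is" for J
      using Cons.prems(1) that by fastforce
    moreover from this have "I \<notin> set Is"
      using Cons.prems(2) by fastforce
    ultimately show ?case
      using Cons by (auto simp: pairwise_insert disjnt_def)
  qed auto
  have sorted: "(\<forall>i<length Is. \<forall>j<length Is. i < j \<longrightarrow> R (Is ! i) (Is ! j)) \<longleftrightarrow> sorted_wrt R Is" for R
    unfolding sorted_wrt_iff_nth_less by (metis order.strict_trans)
  have "(\<forall>I\<in>set Is. I \<noteq> {} \<and> is_interval I) \<longleftrightarrow> {} \<notin> set Is \<and> (\<forall>I\<in>set Is. is_interval I)"
    by auto
  then show ?thesis
    using separated[of Is] sorted[of "\<lambda>I J. \<forall>s\<in>I. \<forall>t\<in>J. s < t"]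
    unfolding interval_partition_def partition_on_def by argo
qed

text \<open>For equal pixels at different indices, a gap greater than 1 excludes exactly equal
  neighbours, hence \<open>distinct_adj\<close>. The \<open>list_all2\<close> form lets both lists
  be cut at the same place.\<close>

lemma admits_iff:
  "admits P \<gamma> Is Ps \<longleftrightarrow>
    interval_partition Is \<and> list_all2 (\<lambda>I Y. Y \<in> P \<and> \<gamma> ` I \<subseteq> Y) Is Ps \<and> distinct_adj Ps"
proof -
  have "(\<forall>i<length Ps. \<forall>j<length Ps. i \<noteq> j \<and> Ps ! i = Ps ! j \<longrightarrow> \<bar>int i - int j\<bar> > 1)
    \<longleftrightarrow> distinct_adj Ps" (is "?L \<longleftrightarrow> _")
  proof
    assume L: ?L
    show "distinct_adj Ps"
      unfolding distinct_adj_conv_nth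
    proof (intro allI impI)
      fix i assume "Suc i < length Ps"
      then show "Ps ! i \<noteq> Ps ! Suc i"
        using L[rule_format, of i "Suc i"] by auto
    qed
  next
    assume d: "distinct_adj Ps"
    show ?L
    proof (intro allI impI, elim conjE)
      fix i j
      assume ij: "i < length Ps" "j < length Ps" "i \<noteq> j" "Ps ! i = Ps ! j"
      then have "j \<noteq> Suc i" "i \<noteq> Suc j"
        using d unfolding distinct_adj_conv_nth by force+
      with ij(3) show "\<bar>int i - int j\<bar> > 1"
        by linarith
    qed
  qed
  then show ?thesis
    unfolding admits_def list_all2_conv_all_nth
    by (metis in_set_conv_nth nth_mem subset_code(1))
qed

text \<open>The union is convex because the pieces leave no gap: a point between two of its points
  lies in some piece, and the pieces of \<open>As\<close> come too early, those of \<open>Bs\<close>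
  too late.\<close>

lemma interval_partition_merge:
  assumes "interval_partition (As @ I # J # Bs)"
  shows "interval_partition (As @ (I \<union> J) # Bs)"
proof -
  have "is_interval (I \<union> J)"
    unfolding is_interval_1
  proof (intro ballI allI impI)
    fix u v z
    assume uv: "u \<in> I \<union> J" "v \<in> I \<union> J" and z: "u \<le> z \<and> z \<le> v"
    have "u \<in> {0..1}" "v \<in> {0..1}"
      using assms uv unfolding interval_partition_iff by auto
    with z have "z \<in> {0..1}" by auto
    also have "{0..1} = \<Union>(set (As @ I # J # Bs))"
      using assms unfolding interval_partition_iff by blast
    finally obtain K where K: "K \<in> set As \<union> {I, J} \<union> set Bs" "z \<in> K"
      by auto
    have "\<forall>L\<in>set As. \<forall>s\<in>L. \<forall>t\<in>I \<union> J. s < t" "\<forall>L\<in>set Bs. \<forall>s\<in>I \<union> J. \<forall>t\<in>L. s < t"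
      using assms by (simp_all add: interval_partition_iff sorted_wrt_append ball_Un)
    then have "K \<notin> set As" "K \<notin> set Bs"
      using uv z K(2) by (meson not_le)+
    with K show "z \<in> I \<union> J" by auto
  qed
  then show ?thesis
    using assms by (auto simp: interval_partition_iff sorted_wrt_append)
qed

lemma not_distinct_adj_decomp:
  assumes "\<not> distinct_adj xs"
  obtains as y bs where "xs = as @ y # y # bs"
proof -
  from assms obtain i where i: "Suc i < length xs" "xs ! i = xs ! Suc i"
    unfolding distinct_adj_conv_nth by blast
  then have "xs = take i xs @ xs ! i # xs ! i # drop (Suc (Suc i)) xs"
    by (metis Cons_nth_drop_Suc Suc_lessD append_take_drop_id)
  then show ?thesis by (rule that)
qed

text \<open>Where two neighbouring pixels agree, their intervals are merged. Each merge shortens the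
  list, so the process ends.\<close>

lemma admits_if_not_adjacent_distinct:
  assumes "interval_partition Is" "list_all2 (\<lambda>I Y. Y \<in> P \<and> \<gamma> ` I \<subseteq> Y) Is Ps"
  shows "\<exists>Is Ps. admits P \<gamma> Is Ps"
  using assms
proof (induction "length Ps" arbitrary: Is Ps rule: less_induct)
  case less
  show ?case
  proof (cases "distinct_adj Ps")
    case True
    with less.prems show ?thesis
      unfolding admits_iff by blast
  next
    case False
    then obtain Cs Z Ds where Ps: "Ps = Cs @ Z # Z # Ds"
      by (rule not_distinct_adj_decomp)
    with less.prems(2) obtain As I J Bs where Is: "Is = As @ I # J # Bs"
      and "list_all2 (\<lambda>I Y. Y \<in> P \<and> \<gamma> ` I \<subseteq> Y) As Cs" "\<gamma> ` I \<subseteq> Z" "\<gamma> ` J \<subseteq> Z" "Z \<in> P"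
        "list_all2 (\<lambda>I Y. Y \<in> P \<and> \<gamma> ` I \<subseteq> Y) Bs Ds"
      by (auto simp: list_all2_append2 list_all2_Cons2)
    then have "list_all2 (\<lambda>I Y. Y \<in> P \<and> \<gamma> ` I \<subseteq> Y) (As @ (I \<union> J) # Bs) (Cs @ Z # Ds)"
      by (auto intro!: list_all2_appendI)
    moreover have "interval_partition (As @ (I \<union> J) # Bs)"
      using less.prems(1) unfolding Is by (rule interval_partition_merge)
    ultimately show ?thesis
      using less.hyps[of "Cs @ Z # Ds"] by (simp add: Ps)
  qed
qed

text \<open>Each pixel is replaced by a coarser one containing it. This may make neighbours equal,
  which the merging above repairs.\<close>

lemma admits_coarser:
  assumes "admits P \<gamma> Is Ps" "refines X P Q"
  shows "\<exists>Is Ps. admits Q \<gamma> Is Ps"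
proof -
  obtain f where f: "\<And>Y. Y \<in> P \<Longrightarrow> f Y \<in> Q \<and> Y \<subseteq> f Y"
    using assms(2) unfolding refines_def by metis
  have "list_all2 (\<lambda>I Y. Y \<in> Q \<and> \<gamma> ` I \<subseteq> Y) Is (map f Ps)"
    unfolding list_all2_map2
  proof (rule list_all2_mono)
    show "list_all2 (\<lambda>I Y. Y \<in> P \<and> \<gamma> ` I \<subseteq> Y) Is Ps"
      using assms(1) unfolding admits_iff by blast
  qed (use f in blast)
  then show ?thesis
    using assms(1) admits_if_not_adjacent_distinct[of Is Q \<gamma>] unfolding admits_def by blast
qed

text \<open>This is the finiteness that (S4) contributes; the cover consists of the listed
  pixels.\<close>

lemma admits_imp_finite_cover:
  assumes "admits P \<gamma> Is Ps"
  shows "\<exists>G. finite G \<and> G \<subseteq> P \<and> pimg \<gamma> \<subseteq> \<Union>G"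
proof (intro exI conjI)
  show "pimg \<gamma> \<subseteq> \<Union>(set Ps)"
  proof
    fix x assume "x \<in> pimg \<gamma>"
    then obtain t where t: "t \<in> {0..1}" "x = \<gamma> t"
      unfolding pimg_def by blast
    then obtain I where "I \<in> set Is" "t \<in> I"
      using assms unfolding admits_def interval_partition_iff by (metis UnionE)
    then obtain i where "i < length Is" "t \<in> Is ! i"
      by (metis in_set_conv_nth)
    then show "x \<in> \<Union>(set Ps)"
      using assms t unfolding admits_def by (metis UnionI image_subset_iff nth_mem)
  qed
qed (use assms in \<open>auto simp: admits_def\<close>)

lemma walk_joined_mono:
  assumes "walk_joined \<Gamma> Y x y" "Y \<subseteq> Z"
  shows "walk_joined \<Gamma> Z x y"
proof -
  obtain n g where "\<forall>i\<le>2 * n. g i \<in> \<Gamma> \<and> pimg (g i) \<subseteq> Y"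
    and "pstart (walk_step g 0) = x" "pend (walk_step g (2 * n)) = y"
      "\<forall>i<2 * n. pend (walk_step g i) = pstart (walk_step g (Suc i))"
    using assms(1) unfolding walk_joined_def by metis
  then show ?thesis
    unfolding walk_joined_def using assms(2) by (intro exI[of _ n] exI[of _ g]) auto
qed

section \<open>Refinement and the screen axioms as separate rules\<close>

lemma partition_on_eqI:
  assumes "partition_on X P" "A \<in> P" "B \<in> P" "x \<in> A" "x \<in> B"
  shows "A = B"
  using assms unfolding partition_on_def disjoint_def by blast

lemma refines_superset:
  assumes "refines X P Q" "A \<in> P"
  obtains B where "B \<in> Q" "A \<subseteq> B"
  using assms unfolding refines_def by metis

text \<open>The common point \<open>x\<close> identifies \<open>B\<close> as the pixel of
  \<open>Q\<close> above \<open>A\<close>. Inclusions between pixels of different stages are mostly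
  obtained this way.\<close>

lemma refines_subset:
  assumes "refines X P Q" "A \<in> P" "B \<in> Q" "x \<in> A" "x \<in> B"
  shows "A \<subseteq> B"
proof -
  obtain B' where B': "B' \<in> Q" "A \<subseteq> B'"
    using assms(1,2) by (rule refines_superset)
  then have "B' = B"
    using partition_on_eqI[of X Q B' B x] assms unfolding refines_def by blast
  with B' show ?thesis by simp
qed

lemma
  assumes "is_screen X \<Gamma> E P"
  shows is_screen_equiv_iff:
      "\<lbrakk>\<gamma> \<in> \<Gamma>; \<gamma>' \<in> \<Gamma>; pstart \<gamma> = pstart \<gamma>'; pend \<gamma> = pend \<gamma>'; Y \<in> P; pimg \<gamma> \<subseteq> Y\<rbrakk> \<Longrightarrow>
        (\<gamma>, \<gamma>') \<in> E \<longleftrightarrow> pimg \<gamma>' \<subseteq> Y"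
    and is_screen_walk_joined: "\<lbrakk>Y \<in> P; x \<in> Y; y \<in> Y\<rbrakk> \<Longrightarrow> walk_joined \<Gamma> Y x y"
    and is_screen_complete_start:
      "\<lbrakk>\<rho> \<in> \<Gamma>; \<gamma> \<in> \<Gamma>; pstart \<rho> = pstart \<gamma>; in_pixel P \<rho>\<rbrakk> \<Longrightarrow>
        \<exists>\<rho>'\<in>\<Gamma>. \<exists>\<gamma>'\<in>\<Gamma>. in_pixel P \<rho>' \<and>
          pend \<gamma> = pstart \<rho>' \<and> pend \<rho> = pstart \<gamma>' \<and> (\<gamma> \<cdot>\<^sub>p \<rho>', \<rho> \<cdot>\<^sub>p \<gamma>') \<in> E"
    and is_screen_complete_end:
      "\<lbrakk>\<rho>' \<in> \<Gamma>; \<gamma>' \<in> \<Gamma>; pend \<rho>' = pend \<gamma>'; in_pixel P \<rho>'\<rbrakk> \<Longrightarrow>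
        \<exists>\<rho>\<in>\<Gamma>. \<exists>\<gamma>\<in>\<Gamma>. in_pixel P \<rho> \<and>
          pend \<gamma> = pstart \<rho>' \<and> pend \<rho> = pstart \<gamma>' \<and> (\<gamma> \<cdot>\<^sub>p \<rho>', \<rho> \<cdot>\<^sub>p \<gamma>') \<in> E"
    and is_screen_admits: "\<gamma> \<in> \<Gamma> \<Longrightarrow> \<exists>Is Ps. admits P \<gamma> Is Ps"
  using assms by (simp_all add: is_screen_def)

lemma is_screen_admits_same:
  assumes "is_screen X \<Gamma> E P"
    and "\<gamma> \<in> \<Gamma>" "\<gamma>' \<in> \<Gamma>" "pstart \<gamma> = pstart \<gamma>'" "pend \<gamma> = pend \<gamma>'"
    and "admits P \<gamma> Is Ps" "admits P \<gamma>' Is Ps"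
  shows "(\<gamma>, \<gamma>') \<in> E"
  using assms(2-) assms(1)[unfolded is_screen_def] by (elim conjE) meson

section \<open>Joins of directed families of partitions\<close>

locale directed_partitions =
  fixes X :: "'a set" and C :: "'a set set set"
  assumes nonempty: "C \<noteq> {}"
    and partition: "P \<in> C \<Longrightarrow> partition_on X P"
    and directed: "P \<in> C \<Longrightarrow> Q \<in> C \<Longrightarrow> \<exists>R\<in>C. refines X P R \<and> refines X Q R"
begin

text \<open>Common coarsenings make this relation transitive without any closure, so points of one
  class share a pixel of a single member of \<open>C\<close>.\<close>

definition join :: "'a set set"
  where "join = X // {(x, y). \<exists>P\<in>C. \<exists>Y\<in>P. x \<in> Y \<and> y \<in> Y}"

lemma equiv_join: "equiv X {(x, y). \<exists>P\<in>C. \<exists>Y\<in>P. x \<in> Y \<and> y \<in> Y}" (is "equiv X ?r")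
proof (rule equivI)
  show "?r \<subseteq> X \<times> X"
    using partition by (auto simp: partition_on_def)
  show "refl_on X ?r"
    using nonempty partition by (fastforce simp: refl_on_def partition_on_def)
  show "sym ?r"
    by (auto simp: sym_def)
  show "trans ?r"
  proof (rule transI)
    fix x y z assume "(x, y) \<in> ?r" "(y, z) \<in> ?r"
    then obtain P A Q B where PQ: "P \<in> C" "Q \<in> C" and A: "A \<in> P" "x \<in> A" "y \<in> A"
      and B: "B \<in> Q" "y \<in> B" "z \<in> B"
      by blast
    \<comment> \<open>\<open>A\<close> and \<open>B\<close> may belong to different members; a pixel
      of the common coarsening \<open>R\<close> that contains \<open>A\<close> also contains
      \<open>B\<close>, as both contain \<open>y\<close>.\<close>
    obtain R where R: "R \<in> C" "refines X P R" "refines X Q R"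
      using directed PQ by blast
    then obtain D where "D \<in> R" "A \<subseteq> D"
      using A unfolding refines_def by blast
    moreover from this have "B \<subseteq> D"
      using refines_subset R(3) A B by (metis subsetD)
    ultimately show "(x, z) \<in> ?r"
      using R(1) A B by blast
  qed
qed

lemma partition_on_join: "partition_on X join"
  unfolding join_def by (rule partition_on_quotient[OF equiv_join])

lemma join_same_pixel:
  assumes "Z \<in> join" "x \<in> Z" "y \<in> Z"
  obtains P Y where "P \<in> C" "Y \<in> P" "x \<in> Y" "y \<in> Y"
  using assms quotient_eq_iff[OF equiv_join, of Z Z x y] unfolding join_def by blast

lemma refines_join:
  assumes "P \<in> C"
  shows "refines X P join"
  unfolding refines_def
proof (intro conjI ballI)
  fix Y assume Y: "Y \<in> P"
  then obtain x where x: "x \<in> Y" "x \<in> X"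
    using partition[OF assms] by (metis UnionI equals0I partition_onD1 partition_onD3)
  then show "\<exists>Z\<in>join. Y \<subseteq> Z"
    unfolding join_def using assms Y by (intro bexI[OF _ quotientI[of x]]) auto
qed (use assms partition partition_on_join in auto)

text \<open>Induction on \<open>G\<close>. Adding a pixel \<open>A\<close> concerns only the join
  pixel \<open>Z\<^sub>0\<close> around it: one further coarsening links \<open>A\<close> to the
  pixel \<open>W\<^sub>0\<close> that already collects the rest of \<open>G\<close> inside
  \<open>Z\<^sub>0\<close>. Staying above \<open>P\<^sub>0\<close> keeps each pixel of
  \<open>G\<close> in one piece.\<close>

lemma join_attained_on_finite:
  assumes "P\<^sub>0 \<in> C" "finite G" "G \<subseteq> P\<^sub>0"
  shows "\<exists>P\<in>C. refines X P\<^sub>0 P \<and> (\<forall>Z\<in>join. \<exists>W\<in>P. W \<subseteq> Z \<and> \<Union>G \<inter> Z \<subseteq> W)"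
  using assms(2,3)
proof (induction G)
  case empty
  \<comment> \<open>With nothing to cover, a pixel inside \<open>Z\<close> must still be exhibited:
    the one through any point of \<open>Z\<close> serves.\<close>
  have "\<exists>W\<in>P\<^sub>0. W \<subseteq> Z" if Z: "Z \<in> join" for Z
  proof -
    obtain x where "x \<in> Z"
      using Z partition_on_join by (metis partition_onD3 ex_in_conv)
    moreover from this obtain W where "W \<in> P\<^sub>0" "x \<in> W"
      using Z partition_on_join partition[OF assms(1)] by (metis UnionE UnionI partition_onD1)
    ultimately show ?thesis
      using refines_subset[OF refines_join[OF assms(1)]] Z by blast
  qed
  then show ?case
    using assms(1) refines_refl[OF partition[OF assms(1)]] by auto
next
  case (insert A G)
  have "A \<in> P\<^sub>0" "G \<subseteq> P\<^sub>0" using insert.prems by auto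
  from insert.IH[OF this(2)] obtain P where P: "P \<in> C" "refines X P\<^sub>0 P"
    and attained: "\<forall>Z\<in>join. \<exists>W\<in>P. W \<subseteq> Z \<and> \<Union>G \<inter> Z \<subseteq> W"
    by (elim bexE conjE) (rule that)
  obtain Z\<^sub>0 where Z\<^sub>0: "Z\<^sub>0 \<in> join" "A \<subseteq> Z\<^sub>0"
    using refines_superset[OF refines_join[OF assms(1)] \<open>A \<in> P\<^sub>0\<close>] .
  obtain W\<^sub>0 where W\<^sub>0: "W\<^sub>0 \<in> P" "W\<^sub>0 \<subseteq> Z\<^sub>0" "\<Union>G \<inter> Z\<^sub>0 \<subseteq> W\<^sub>0"
    using bspec[OF attained Z\<^sub>0(1)] by metis
  \<comment> \<open>One point from each suffices: at any stage above \<open>P\<close>, a pixel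
    containing \<open>a\<close> and \<open>w\<close> contains all of \<open>A\<close> and
    \<open>W\<^sub>0\<close>.\<close>
  obtain a w where aw: "a \<in> A" "w \<in> W\<^sub>0"
    using \<open>A \<in> P\<^sub>0\<close> \<open>W\<^sub>0 \<in> P\<close> partition[OF assms(1)] partition[OF P(1)]
    by (metis partition_onD3 ex_in_conv)
  have "a \<in> Z\<^sub>0" "w \<in> Z\<^sub>0"
    using aw Z\<^sub>0(2) W\<^sub>0(2) by blast+
  then obtain P' V where P': "P' \<in> C" "V \<in> P'" "a \<in> V" "w \<in> V"
    using join_same_pixel Z\<^sub>0(1) by metis
  \<comment> \<open>The stage \<open>P'\<close> where \<open>a\<close> meets \<open>w\<close> need
    not lie above \<open>P\<close>; passing to \<open>R\<close> keeps the link and what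
    \<open>P\<close> has already collected.\<close>
  obtain R where R: "R \<in> C" "refines X P R" "refines X P' R"
    using directed P(1) P'(1) by blast
  have R0: "refines X P\<^sub>0 R"
    using P(2) R(2) by (rule refines_trans)
  obtain D where D: "D \<in> R" "V \<subseteq> D"
    using R(3) P'(2) by (rule refines_superset)
  have AD: "A \<subseteq> D" and WD: "W\<^sub>0 \<subseteq> D"
    using refines_subset[OF R0 \<open>A \<in> P\<^sub>0\<close> D(1) aw(1)] refines_subset[OF R(2) W\<^sub>0(1) D(1) aw(2)]
      P'(3,4) D(2) by blast+
  have "\<exists>W\<in>R. W \<subseteq> Z \<and> \<Union>(insert A G) \<inter> Z \<subseteq> W" if Z: "Z \<in> join" for Z
  proof (cases "Z = Z\<^sub>0")
    case True
    have "D \<subseteq> Z\<^sub>0"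
      using refines_subset[OF refines_join[OF R(1)] D(1) Z\<^sub>0(1) _ \<open>a \<in> Z\<^sub>0\<close>] aw(1) AD by blast
    then show ?thesis
      using True AD WD W\<^sub>0(3) by (intro bexI[OF _ D(1)]) auto
  next
    case False
    \<comment> \<open>Such a \<open>Z\<close> gains nothing from \<open>A\<close>, so its old pixel
      \<open>W\<close> only has to be followed to the stage \<open>R\<close>, where it remains
      inside \<open>Z\<close>.\<close>
    then have "A \<inter> Z = {}"
      using partition_on_eqI[OF partition_on_join Z Z\<^sub>0(1)] Z\<^sub>0(2) by fast
    obtain W where W: "W \<in> P" "W \<subseteq> Z" "\<Union>G \<inter> Z \<subseteq> W"
      using bspec[OF attained Z] by metis
    obtain W' where W': "W' \<in> R" "W \<subseteq> W'"
      using R(2) W(1) by (rule refines_superset)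
    have "W' \<subseteq> Z"
    proof -
      obtain u where "u \<in> W"
        using W(1) partition[OF P(1)] by (metis partition_onD3 ex_in_conv)
      then show ?thesis
        using refines_subset[OF refines_join[OF R(1)] W'(1) Z] W(2) W'(2) by (meson subsetD)
    qed
    then show ?thesis
      using \<open>A \<inter> Z = {}\<close> W(3) W'(2) by (intro bexI[OF _ W'(1)]) auto
  qed
  with R0 show ?case
    by (intro bexI[OF _ R(1)] conjI ballI)
qed

text \<open>Two paths are handled at once because (S1) and (S5) compare two. Their finite covers at
  one stage \<open>P\<^sub>0\<close> together form the set to which the previous lemma
  applies.\<close>

lemma join_attained_on_paths:
  assumes "\<And>P. P \<in> C \<Longrightarrow> \<exists>Is Ps. admits P \<gamma> Is Ps" "\<And>P. P \<in> C \<Longrightarrow> \<exists>Is Ps. admits P \<gamma>' Is Ps"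
  obtains P where "P \<in> C" "\<And>Z. Z \<in> join \<Longrightarrow> \<exists>W\<in>P. W \<subseteq> Z \<and> (pimg \<gamma> \<union> pimg \<gamma>') \<inter> Z \<subseteq> W"
proof -
  obtain P\<^sub>0 where P\<^sub>0: "P\<^sub>0 \<in> C"
    using nonempty by blast
  obtain G where G: "finite G" "G \<subseteq> P\<^sub>0" "pimg \<gamma> \<subseteq> \<Union>G"
    using assms(1)[OF P\<^sub>0] admits_imp_finite_cover by metis
  obtain G' where G': "finite G'" "G' \<subseteq> P\<^sub>0" "pimg \<gamma>' \<subseteq> \<Union>G'"
    using assms(2)[OF P\<^sub>0] admits_imp_finite_cover by metis
  obtain P where P: "P \<in> C" "\<forall>Z\<in>join. \<exists>W\<in>P. W \<subseteq> Z \<and> \<Union>(G \<union> G') \<inter> Z \<subseteq> W"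
    using join_attained_on_finite[OF P\<^sub>0, of "G \<union> G'"] G(1,2) G'(1,2) by auto
  have cover: "pimg \<gamma> \<union> pimg \<gamma>' \<subseteq> \<Union>(G \<union> G')"
    using G(3) G'(3) by auto
  show ?thesis
  proof (rule that[OF P(1)])
    fix Z assume "Z \<in> join"
    with P(2) obtain W where "W \<in> P" "W \<subseteq> Z" "\<Union>(G \<union> G') \<inter> Z \<subseteq> W"
      by metis
    then show "\<exists>W\<in>P. W \<subseteq> Z \<and> (pimg \<gamma> \<union> pimg \<gamma>') \<inter> Z \<subseteq> W"
      using cover by (meson Int_mono order_refl order_trans)
  qed
qed

end

section \<open>Joins of directed families of screens\<close>

locale directed_screens = directed_partitions +
  fixes \<Gamma> :: "'a pth set" and E :: "('a pth \<times> 'a pth) set"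
  assumes screen: "P \<in> C \<Longrightarrow> is_screen X \<Gamma> E P"
begin

lemma screen_admits: "P \<in> C \<Longrightarrow> \<gamma> \<in> \<Gamma> \<Longrightarrow> \<exists>Is Ps. admits P \<gamma> Is Ps"
  using is_screen_admits[OF screen] .

lemma join_admits:
  assumes "\<gamma> \<in> \<Gamma>"
  shows "\<exists>Is Ps. admits join \<gamma> Is Ps"
proof -
  obtain P where P: "P \<in> C"
    using nonempty by blast
  then show ?thesis
    using screen_admits[OF P assms] admits_coarser[OF _ refines_join[OF P]] by metis
qed

lemma join_pixel_stage:
  assumes "\<gamma> \<in> \<Gamma>" "\<gamma>' \<in> \<Gamma>"
  obtains P where "P \<in> C" "\<And>Z. Z \<in> join \<Longrightarrow> \<exists>W\<in>P. W \<subseteq> Z \<and> (pimg \<gamma> \<union> pimg \<gamma>') \<inter> Z \<subseteq> W"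
  using join_attained_on_paths[OF screen_admits[OF _ assms(1)] screen_admits[OF _ assms(2)]] that
  by metis

text \<open>This reduces (S3) to a single stage. From left to right, the stage lemma is applied to
  the pair of \<open>\<gamma>\<close> with itself.\<close>

lemma in_pixel_join_iff:
  assumes "\<gamma> \<in> \<Gamma>"
  shows "in_pixel join \<gamma> \<longleftrightarrow> (\<exists>P\<in>C. in_pixel P \<gamma>)"
proof
  assume "in_pixel join \<gamma>"
  then obtain Z where Z: "Z \<in> join" "pimg \<gamma> \<subseteq> Z"
    unfolding in_pixel_def by blast
  obtain P W where "P \<in> C" "W \<in> P" "(pimg \<gamma> \<union> pimg \<gamma>) \<inter> Z \<subseteq> W"
    using join_pixel_stage[OF assms assms] Z(1) by metis
  with Z(2) show "\<exists>P\<in>C. in_pixel P \<gamma>"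
    unfolding in_pixel_def by blast
next
  assume "\<exists>P\<in>C. in_pixel P \<gamma>"
  then show "in_pixel join \<gamma>"
    using refines_superset[OF refines_join] unfolding in_pixel_def by (metis subset_trans)
qed

text \<open>(S1) for the join. At a stage whose pixel \<open>W\<close> collects all that the two
  images have in \<open>Z\<close>, lying in \<open>Z\<close> and lying in \<open>W\<close> amount to
  the same, and (S1) of that stage decides.\<close>

lemma join_equiv_iff:
  assumes \<gamma>: "\<gamma> \<in> \<Gamma>" "\<gamma>' \<in> \<Gamma>" "pstart \<gamma> = pstart \<gamma>'" "pend \<gamma> = pend \<gamma>'"
    and Z: "Z \<in> join" "pimg \<gamma> \<subseteq> Z"
  shows "(\<gamma>, \<gamma>') \<in> E \<longleftrightarrow> pimg \<gamma>' \<subseteq> Z"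
proof -
  obtain P W where P: "P \<in> C" "W \<in> P" "W \<subseteq> Z" "(pimg \<gamma> \<union> pimg \<gamma>') \<inter> Z \<subseteq> W"
    using join_pixel_stage[OF \<gamma>(1,2)] Z(1) by metis
  then have "pimg \<gamma> \<subseteq> W" "pimg \<gamma>' \<subseteq> W \<longleftrightarrow> pimg \<gamma>' \<subseteq> Z"
    using Z(2) by blast+
  then show ?thesis
    using is_screen_equiv_iff[OF screen[OF P(1)] \<gamma> P(2)] by metis
qed

lemma join_walk_joined:
  assumes "Z \<in> join" "x \<in> Z" "y \<in> Z"
  shows "walk_joined \<Gamma> Z x y"
proof -
  obtain P Y where P: "P \<in> C" "Y \<in> P" "x \<in> Y" "y \<in> Y"
    using assms by (rule join_same_pixel)
  then have "walk_joined \<Gamma> Y x y"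
    using is_screen_walk_joined[OF screen] by metis
  moreover have "Y \<subseteq> Z"
    using refines_subset[OF refines_join[OF P(1)] P(2) assms(1) P(3) assms(2)] .
  ultimately show ?thesis
    by (rule walk_joined_mono)
qed

text \<open>(S5) for the join. Replacing each listed join pixel \<open>Z\<close> by its stage pixel
  \<open>f Z\<close> turns the common data into common data for one screen \<open>P\<close>, to
  which (S5) applies.\<close>

lemma join_admits_same_imp_equiv:
  assumes \<gamma>: "\<gamma> \<in> \<Gamma>" "\<gamma>' \<in> \<Gamma>" "pstart \<gamma> = pstart \<gamma>'" "pend \<gamma> = pend \<gamma>'"
    and admits: "admits join \<gamma> Is Ps" "admits join \<gamma>' Is Ps"
  shows "(\<gamma>, \<gamma>') \<in> E"
proof -
  obtain P f where P: "P \<in> C" and f: "\<And>Z. Z \<in> join \<Longrightarrow> f Z \<in> P"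
      "\<And>Z. Z \<in> join \<Longrightarrow> f Z \<subseteq> Z" "\<And>Z. Z \<in> join \<Longrightarrow> (pimg \<gamma> \<union> pimg \<gamma>') \<inter> Z \<subseteq> f Z"
    using join_pixel_stage[OF \<gamma>(1,2)] by metis
  \<comment> \<open>Injectivity keeps neighbouring pixels distinct after \<open>f\<close> is
    applied. It holds since \<open>f Z\<close> is a nonempty part of \<open>Z\<close> and the join
    pixels are disjoint.\<close>
  have "inj_on f join"
  proof (rule inj_onI)
    fix Y Z assume YZ: "Y \<in> join" "Z \<in> join" "f Y = f Z"
    then obtain u where "u \<in> f Y"
      using f(1) partition[OF P] by (metis partition_onD3 ex_in_conv)
    then show "Y = Z"
      using YZ f(2) partition_on_eqI[OF partition_on_join] by (metis subsetD)
  qed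
  \<comment> \<open>Here \<open>\<delta>\<close> stands for either of the two paths; the new list
    does not depend on which.\<close>
  have "admits P \<delta> Is (map f Ps)"
    if \<delta>: "admits join \<delta> Is Ps" "pimg \<delta> \<subseteq> pimg \<gamma> \<union> pimg \<gamma>'" for \<delta>
  proof -
    have sub: "\<delta> ` I \<subseteq> pimg \<delta>" if "I \<in> set Is" for I
      using \<delta>(1) that unfolding admits_iff interval_partition_iff pimg_def by blast
    have "list_all2 (\<lambda>I Y. Y \<in> P \<and> \<delta> ` I \<subseteq> Y) Is (map f Ps)"
      unfolding list_all2_map2
    proof (rule list.rel_mono_strong)
      show "list_all2 (\<lambda>I Y. Y \<in> join \<and> \<delta> ` I \<subseteq> Y) Is Ps"
        using \<delta>(1) unfolding admits_iff by blast
    next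
      fix I Z assume I: "I \<in> set Is" and "Z \<in> join \<and> \<delta> ` I \<subseteq> Z"
      then show "f Z \<in> P \<and> \<delta> ` I \<subseteq> f Z"
        using sub[OF I] \<delta>(2) f(1,3)[of Z] by blast
    qed
    moreover have "set Ps \<subseteq> join"
      using \<delta>(1) unfolding admits_def by blast
    then have "distinct_adj (map f Ps)"
      using \<delta>(1) \<open>inj_on f join\<close> unfolding admits_iff
      by (metis distinct_adj_mapI inj_on_subset)
    ultimately show ?thesis
      using \<delta>(1) unfolding admits_iff by blast
  qed
  then show ?thesis
    using is_screen_admits_same[OF screen[OF P] \<gamma>] admits by (metis Un_upper1 Un_upper2)
qed

text \<open>The two cases written out are the halves of (S3): a stage that has the given short path
  in a pixel supplies the completing square, and its other short path lies in a pixel of that stage,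
  hence of the join.\<close>

lemma is_screen_join: "is_screen X \<Gamma> E join"
  unfolding is_screen_def
proof (intro conjI ballI allI impI; (elim conjE)?)
  fix \<rho> \<gamma> assume "\<rho> \<in> \<Gamma>" "\<gamma> \<in> \<Gamma>" "pstart \<rho> = pstart \<gamma>" "in_pixel join \<rho>"
  moreover from this obtain P where "P \<in> C" "in_pixel P \<rho>"
    using in_pixel_join_iff by metis
  ultimately obtain \<rho>' \<gamma>' where "\<rho>' \<in> \<Gamma>" "\<gamma>' \<in> \<Gamma>" "in_pixel P \<rho>'"
      "pend \<gamma> = pstart \<rho>'" "pend \<rho> = pstart \<gamma>'" "(\<gamma> \<cdot>\<^sub>p \<rho>', \<rho> \<cdot>\<^sub>p \<gamma>') \<in> E"
    using is_screen_complete_start[OF screen, of P \<rho> \<gamma>] by metis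
  then show "\<exists>\<rho>'\<in>\<Gamma>. \<exists>\<gamma>'\<in>\<Gamma>. in_pixel join \<rho>' \<and>
      pend \<gamma> = pstart \<rho>' \<and> pend \<rho> = pstart \<gamma>' \<and> (\<gamma> \<cdot>\<^sub>p \<rho>', \<rho> \<cdot>\<^sub>p \<gamma>') \<in> E"
    using \<open>P \<in> C\<close> in_pixel_join_iff by metis
next
  fix \<rho>' \<gamma>' assume "\<rho>' \<in> \<Gamma>" "\<gamma>' \<in> \<Gamma>" "pend \<rho>' = pend \<gamma>'" "in_pixel join \<rho>'"
  moreover from this obtain P where "P \<in> C" "in_pixel P \<rho>'"
    using in_pixel_join_iff by metis
  ultimately obtain \<rho> \<gamma> where "\<rho> \<in> \<Gamma>" "\<gamma> \<in> \<Gamma>" "in_pixel P \<rho>"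
      "pend \<gamma> = pstart \<rho>'" "pend \<rho> = pstart \<gamma>'" "(\<gamma> \<cdot>\<^sub>p \<rho>', \<rho> \<cdot>\<^sub>p \<gamma>') \<in> E"
    using is_screen_complete_end[OF screen, of P \<rho>' \<gamma>'] by metis
  then show "\<exists>\<rho>\<in>\<Gamma>. \<exists>\<gamma>\<in>\<Gamma>. in_pixel join \<rho> \<and>
      pend \<gamma> = pstart \<rho>' \<and> pend \<rho> = pstart \<gamma>' \<and> (\<gamma> \<cdot>\<^sub>p \<rho>', \<rho> \<cdot>\<^sub>p \<gamma>') \<in> E"
    using \<open>P \<in> C\<close> in_pixel_join_iff by metis
qed (use partition_on_join join_equiv_iff join_walk_joined join_admits
      join_admits_same_imp_equiv in auto)

end

section \<open>Maximal screens by Zorn's lemma\<close>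

theorem proposition1p16:
  fixes X :: "'a set" and \<Gamma> :: "'a pth set" and E :: "('a pth \<times> 'a pth) set"
  assumes "path_triple X \<Gamma> E"
    and "screens X \<Gamma> E \<noteq> {}"
  shows "\<exists>P\<in>screens X \<Gamma> E. \<forall>Q\<in>screens X \<Gamma> E. refines X P Q \<longrightarrow> Q = P"
proof (rule predicate_Zorn)
  have partition: "partition_on X P" if "P \<in> screens X \<Gamma> E" for P
    using that by (simp add: screens_def is_screen_def)
  show "partial_order_on (screens X \<Gamma> E) (relation_of (refines X) (screens X \<Gamma> E))"
    by (rule partial_order_on_relation_ofI)
      (erule refines_refl[OF partition] refines_trans refines_asym; assumption)+
  fix C assume chain: "C \<in> Chains (relation_of (refines X) (screens X \<Gamma> E))"
  show "\<exists>U\<in>screens X \<Gamma> E. \<forall>P\<in>C. refines X P U"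
  proof (cases "C = {}")
    case True
    \<comment> \<open>The empty chain has no join to offer; any screen bounds it.\<close>
    then show ?thesis using assms(2) by blast
  next
    case False
    have C: "C \<subseteq> screens X \<Gamma> E"
      using chain by (rule Chains_relation_of)
    \<comment> \<open>Of two members of a chain, the coarser one is a common coarsening.\<close>
    interpret directed_screens X C \<Gamma> E
    proof
      fix P Q assume "P \<in> C" "Q \<in> C"
      then have "refines X P Q \<or> refines X Q P"
        using chain by (auto simp: Chains_def relation_of_def)
      then show "\<exists>R\<in>C. refines X P R \<and> refines X Q R"
        using \<open>P \<in> C\<close> \<open>Q \<in> C\<close> refines_refl partition C by blast
    qed (use False C partition in \<open>auto simp: screens_def\<close>)
    show ?thesis
      using is_screen_join refines_join by (auto simp: screens_def)
  qed
qed

end
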